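(* Let $\mathbf{k}$ be a field and $\Pi$ a finite poset. If $I^k,\eta^{k-1}$ is the input and $I^{k+1},\eta^k$ the output of the algorithm "Step in the minimal injective resolution" (described in the context), then the sequence $I^{k-1}\xrightarrow{\eta^{k-1}}I^k\xrightarrow{\eta^k}I^{k+1}$ is exact in $I^k$, i.e. $\operatorname{im}\eta^{k-1}(\sigma)=\ker\eta^k(\sigma)$ for every $\sigma\in\Pi$.
   Context: A sheaf $F$ on a finite poset $\Pi$ assigns to each $\pi\in\Pi$ a finite-dimensional $\mathbf{k}$-vector space $F(\pi)$ and to each relation $\tau\le\gamma$ a linear map $F(\tau\le\gamma)$, functorially; natural transformations are collections of linear maps commuting with the sheaf maps; kernels and images are pointwise. For $\pi\in\Pi$, the sheaf $[\pi]$ has $[\pi](\gamma)=\mathbf{k}$ if $\gamma\le\pi$ and $0$ otherwise, with identity maps $[\pi](\gamma\le\tau)$ when $\gamma\le\tau\le\pi$ and zero maps otherwise. Injective sheaves are, up to isomorphism, the finite direct sums of sheaves $[\pi]$. Write $\mathrm{St}\,\sigma=\{\tau\in\Pi:\sigma\le\tau\}$. Representation. An injective sheaf $I=\bigoplus_{i=1}^l[\pi_i]$ is represented by the tuple $(\pi_1,\dots,\pi_l)$ of its generators (repetitions allowed). A natural transformation $\eta:I\to J$ between injective sheaves is represented by one matrix with columns labeled by the generators of $I$ and rows labeled by the generators of $J$; the entry in a row labeled $\sigma$ and a column labeled $\pi$ is the scalar giving the component $[\pi]\to[\sigma]$, and is $0$ unless $\sigma\le\pi$. For $\sigma\in\Pi$,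 the linear map $\eta(\sigma)$ is given by the submatrix $\eta[\mathrm{St}\,\sigma,\mathrm{St}\,\sigma]$ of the rows and columns labeled by elements of $\mathrm{St}\,\sigma$. Conversely every such matrix defines a natural transformation. Algorithm ("Step in the minimal injective resolution"). Input: an injective sheaf $I^k$ and a natural transformation $\eta^{k-1}:I^{k-1}\to I^k$ with $I^{k-1}$ injective, where $I^{k-1}$ and $I^k$ are represented by their tuples of generators and $\eta^{k-1}$ is represented by the matrix with columns labeled by the generators of $I^{k-1}$ and rows labeled by the generators of $I^k$, whose entry in a row labeled $\sigma$ and a column labeled $\pi$ is the scalar giving the component $[\pi]\to[\sigma]$. (For $k=0$ one may take $I^{-1}=F$ an arbitrary sheaf and $\eta^{-1}=\alpha:F\to I^0$, given by the matrices $\alpha(\sigma)$, $\sigma\in\Pi$, with rows labeled by the generators of $I^0$ in $\mathrm{St}\,\sigma$.) Fix a total order $(\sigma_1,\dots,\sigma_n)$ of the elements of $\Pi$ extending its partial order. Start with $I^{k+1}$ empty and $\eta^k$ an empty matrix (no rows, columns labeled by the generators of $I^k$). For $\sigma=\sigma_n,\sigma_{n-1},\dots,\sigma_1$ in this order: let $B$ be a basis of $(\operatorname{im}\eta^{k-1}(\sigma))^\perp=\{v\in\mathbf{k}^{\dim I^k(\sigma)}: v\cdot u=0\ \text{for all } u\in\operatorname{im}\eta^{k-1}(\sigma)\}$; for each $b\in B$ in turn, if $b$ is linearly independent from the current rows of $\eta^k(\sigma)$, append $\sigma$ to the tuple $I^{k+1}$ and add $b$ as the next row of $\eta^k$, labeled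 by $\sigma$, with entries $0$ in the columns labeled by $\Pi\setminus\mathrm{St}\,\sigma$. Output: $I^{k+1},\eta^k$. *)

theory Defs
  imports
    "Jordan_Normal_Form.VS_Connect"
    "Jordan_Normal_Form.DL_Submatrix"
begin

section \<open>Sheaves on a poset\<close>

text \<open>A poset is a type of class \<^class>\<open>order\<close>. Vector spaces over the field \<open>'a\<close> are those of
  the theory VectorSpace, with scalars \<open>class_ring\<close>.\<close>

record ('p, 'a, 'v) sheaf =
  stalk :: "'p \<Rightarrow> ('a, 'v) module"
  res :: "'p \<Rightarrow> 'p \<Rightarrow> 'v \<Rightarrow> 'v"

definition is_sheaf :: "('p::order, 'a::field, 'v) sheaf \<Rightarrow> bool" where
  "is_sheaf F \<longleftrightarrow>
     (\<forall>\<sigma>. vectorspace class_ring (stalk F \<sigma>) \<and> vectorspace.fin_dim class_ring (stalk F \<sigma>)) \<and>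
     (\<forall>\<sigma> \<tau>. \<sigma> \<le> \<tau> \<longrightarrow> linear_map class_ring (stalk F \<sigma>) (stalk F \<tau>) (res F \<sigma> \<tau>)) \<and>
     (\<forall>\<sigma>. \<forall>v\<in>carrier (stalk F \<sigma>). res F \<sigma> \<sigma> v = v) \<and>
     (\<forall>\<rho> \<sigma> \<tau>. \<rho> \<le> \<sigma> \<longrightarrow> \<sigma> \<le> \<tau> \<longrightarrow>
        (\<forall>v\<in>carrier (stalk F \<rho>). res F \<sigma> \<tau> (res F \<rho> \<sigma> v) = res F \<rho> \<tau> v))"

definition nat_trans ::
  "('p::order, 'a::field, 'v) sheaf \<Rightarrow> ('p, 'a, 'w) sheaf \<Rightarrow> ('p \<Rightarrow> 'v \<Rightarrow> 'w) \<Rightarrow> bool" where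
  "nat_trans F G \<eta> \<longleftrightarrow>
     (\<forall>\<sigma>. linear_map class_ring (stalk F \<sigma>) (stalk G \<sigma>) (\<eta> \<sigma>)) \<and>
     (\<forall>\<sigma> \<tau>. \<sigma> \<le> \<tau> \<longrightarrow>
        (\<forall>v\<in>carrier (stalk F \<sigma>). \<eta> \<tau> (res F \<sigma> \<tau> v) = res G \<sigma> \<tau> (\<eta> \<sigma> v)))"

definition exact_at ::
  "('p::order, 'a::field, 'u) sheaf \<Rightarrow> ('p \<Rightarrow> 'u \<Rightarrow> 'v) \<Rightarrow> ('p, 'a, 'v) sheaf \<Rightarrow>
   ('p \<Rightarrow> 'v \<Rightarrow> 'w) \<Rightarrow> ('p, 'a, 'w) sheaf \<Rightarrow> bool" where
  "exact_at F \<eta> G \<theta> H \<longleftrightarrow>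
     nat_trans F G \<eta> \<and> nat_trans G H \<theta> \<and>
     (\<forall>\<sigma>. \<eta> \<sigma> ` carrier (stalk F \<sigma>) =
          {v \<in> carrier (stalk G \<sigma>). \<theta> \<sigma> v = \<zero>\<^bsub>stalk H \<sigma>\<^esub>})"


section \<open>Injective sheaves given by tuples of generators\<close>

text \<open>The list \<open>I = [\<pi>\<^sub>1, \<dots>, \<pi>\<^sub>l]\<close> stands for the direct sum of the sheaves \<open>[\<pi>\<^sub>i]\<close>. The summand
  \<open>[\<pi>\<^sub>i]\<close> is nonzero at \<open>\<sigma>\<close> iff \<open>\<pi>\<^sub>i \<in> St \<sigma>\<close>, so the stalk at \<open>\<sigma>\<close> has the
  coordinates \<open>star_idx I \<sigma>\<close>, renumbered increasingly from \<open>0\<close> (by \<^const>\<open>pick\<close>, as in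
  \<^const>\<open>submatrix\<close>).\<close>

definition St :: "'p::order \<Rightarrow> 'p set" where
  "St \<sigma> = {\<tau>. \<sigma> \<le> \<tau>}"

definition star_idx :: "'p::order list \<Rightarrow> 'p \<Rightarrow> nat set" where
  "star_idx I \<sigma> = {i. i < length I \<and> I ! i \<in> St \<sigma>}"

definition stalk_dim :: "'p::order list \<Rightarrow> 'p \<Rightarrow> nat" where
  "stalk_dim I \<sigma> = card (star_idx I \<sigma>)"

text \<open>Conversion between vectors on all generators of \<open>I\<close> and vectors on those in \<open>St \<sigma>\<close>.\<close>

definition extend_zero :: "'p::order list \<Rightarrow> 'p \<Rightarrow> 'a::zero vec \<Rightarrow> 'a vec" where
  "extend_zero I \<sigma> v =
     vec (length I) (\<lambda>j. if j \<in> star_idx I \<sigma> then v $ card {i \<in> star_idx I \<sigma>. i < j} else 0)"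

definition restrict_star :: "'p::order list \<Rightarrow> 'p \<Rightarrow> 'a vec \<Rightarrow> 'a vec" where
  "restrict_star I \<sigma> w = vec (stalk_dim I \<sigma>) (\<lambda>k. w $ pick (star_idx I \<sigma>) k)"

text \<open>For \<open>\<sigma> \<le> \<tau>\<close> the map \<open>[\<pi>\<^sub>i](\<sigma> \<le> \<tau>)\<close> is the identity if \<open>\<pi>\<^sub>i \<in> St \<tau>\<close> and zero otherwise, so
  on the direct sum the coordinates outside \<open>star_idx I \<tau>\<close> are deleted.\<close>

definition inj_sheaf :: "'p::order list \<Rightarrow> ('p, 'a::field, 'a vec) sheaf" where
  "inj_sheaf I =
     \<lparr>stalk = (\<lambda>\<sigma>. module_vec TYPE('a) (stalk_dim I \<sigma>)),
      res = (\<lambda>\<sigma> \<tau> v. restrict_star I \<tau> (extend_zero I \<sigma> v))\<rparr>"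

text \<open>Matrices representing natural transformations \<open>inj_sheaf I \<rightarrow> inj_sheaf J\<close>: columns are
  labeled by \<open>I\<close>, rows by \<open>J\<close>.\<close>

definition nt_matrix :: "'p::order list \<Rightarrow> 'p list \<Rightarrow> 'a::field mat \<Rightarrow> bool" where
  "nt_matrix I J M \<longleftrightarrow>
     M \<in> carrier_mat (length J) (length I) \<and>
     (\<forall>r < length J. \<forall>c < length I. \<not> J ! r \<le> I ! c \<longrightarrow> M $$ (r, c) = 0)"

definition star_submatrix :: "'p::order list \<Rightarrow> 'p list \<Rightarrow> 'a mat \<Rightarrow> 'p \<Rightarrow> 'a mat" where
  "star_submatrix I J M \<sigma> = submatrix M (star_idx J \<sigma>) (star_idx I \<sigma>)"

definition nt_of_matrix ::
  "'p::order list \<Rightarrow> 'p list \<Rightarrow> 'a::field mat \<Rightarrow> 'p \<Rightarrow> 'a vec \<Rightarrow> 'a vec" where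
  "nt_of_matrix I J M \<sigma> v = star_submatrix I J M \<sigma> *\<^sub>v v"


section \<open>One step of the minimal injective resolution\<close>

text \<open>A state consists of the labels found so far and the matrix whose rows they label. A vector
  is linearly independent from the current rows if it is not in their span; the rows themselves
  may be linearly dependent.\<close>

definition process_vector ::
  "'p::order list \<Rightarrow> 'p \<Rightarrow> 'a::field vec \<Rightarrow> 'p list \<times> 'a mat \<Rightarrow> 'p list \<times> 'a mat" where
  "process_vector I \<sigma> b = (\<lambda>(J, N).
     if b \<in> LinearCombinations.module.span class_ring (module_vec TYPE('a) (stalk_dim I \<sigma>))
              (set (rows (star_submatrix I J N \<sigma>)))
     then (J, N)
     else (J @ [\<sigma>], N @\<^sub>r mat_of_row (extend_zero I \<sigma> b)))"

definition resolution_run ::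
  "'p::order list \<Rightarrow> 'p list \<Rightarrow> ('p \<Rightarrow> 'a::field vec list) \<Rightarrow> 'p list \<times> 'a mat" where
  "resolution_run I \<sigma>s B =
     fold (\<lambda>\<sigma>. fold (process_vector I \<sigma>) (B \<sigma>)) (rev \<sigma>s) ([], 0\<^sub>m 0 (length I))"

definition linear_extension :: "'p::order list \<Rightarrow> bool" where
  "linear_extension \<sigma>s \<longleftrightarrow>
     distinct \<sigma>s \<and> set \<sigma>s = UNIV \<and>
     (\<forall>i < length \<sigma>s. \<forall>j < length \<sigma>s. \<sigma>s ! i \<le> \<sigma>s ! j \<longrightarrow> i \<le> j)"

definition ordered_basis :: "nat \<Rightarrow> 'a::field vec set \<Rightarrow> 'a vec list \<Rightarrow> bool" where
  "ordered_basis n W bs \<longleftrightarrow>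
     distinct bs \<and>
     vectorspace.basis class_ring ((module_vec TYPE('a) n)\<lparr>carrier := W\<rparr>) (set bs)"

text \<open>The possible outputs, over all choices of the total order and of the (enumerated) bases. The
  input morphism \<open>\<eta>\<close> enters only through the images of the maps \<open>\<eta> \<sigma>\<close>.\<close>

definition resolution_step ::
  "('p::order, 'a::field, 'v) sheaf \<Rightarrow> ('p \<Rightarrow> 'v \<Rightarrow> 'a vec) \<Rightarrow> 'p list \<Rightarrow>
   'p list \<times> 'a mat \<Rightarrow> bool" where
  "resolution_step F \<eta> I out \<longleftrightarrow>
     (\<exists>\<sigma>s B. linear_extension \<sigma>s \<and>
       (\<forall>\<sigma>. ordered_basis (stalk_dim I \<sigma>)
              (vec_module.orthogonal_complement (stalk_dim I \<sigma>) (\<eta> \<sigma> ` carrier (stalk F \<sigma>)))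
              (B \<sigma>)) \<and>
       out = resolution_run I \<sigma>s B)"

end

theory Submission
  imports Defs
begin

text \<open>At every \<open>\<sigma>\<close> two subspaces of the same coordinate space have to agree, the image of \<open>\<eta> \<sigma>\<close> and
  the kernel of the resulting matrix, cut down to the rows and columns labeled in \<open>St \<sigma>\<close>. The
  kernel of a matrix is the orthogonal complement of its row space, and a subspace \<open>W\<close> of a
  coordinate space over any field satisfies \<open>W\<^sup>\<bottom>\<^sup>\<bottom> = W\<close> (\<open>double_orthogonal_complement\<close>). So it is
  enough that the rows at \<open>\<sigma>\<close> span the orthogonal complement of the image
  (\<open>span_star_rows_resolution_step\<close>).

  They span at least that much: when a basis vector of the complement is processed, it either
  lies in the span of the rows at \<open>\<sigma>\<close> already or becomes one of them, and no row is ever removed.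

  They span no more: a row appended while \<open>\<rho>\<close> is processed is the extension by zero of a vector
  \<open>b\<close> orthogonal to the image of \<open>\<eta> \<rho>\<close>, and it is visible only at those \<open>\<sigma>\<close> with \<open>\<sigma> \<le> \<rho>\<close>. Its
  part at \<open>\<sigma>\<close> pairs with \<open>\<eta> \<sigma> x\<close> as \<open>b\<close> pairs with the restriction of \<open>\<eta> \<sigma> x\<close> to \<open>\<rho>\<close>, because
  extension by zero is adjoint to deletion of coordinates (\<open>restrict_star_scalar_prod\<close>). By
  naturality that restriction is in the image of \<open>\<eta> \<rho>\<close>, so the product is zero.\<close>

section \<open>Orthogonal complements in coordinate spaces\<close>

context vec_space
begin

text \<open>The standard scalar product on a coordinate space over an arbitrary field can have isotropic
  vectors, so orthogonal projection is not available. Instead the functional \<open>w\<close> is found by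
  elimination on the generators. For a new generator \<open>b\<close> outside the span of \<open>bs\<close>, choose \<open>u\<close>
  that kills \<open>bs\<close> and takes the value \<open>1\<close> at \<open>b\<close>. Then subtracting a multiple
  of \<open>b\<close> moves \<open>v\<close> into the kernel of \<open>u\<close>, and subtracting a multiple of \<open>u\<close> corrects a functional for the moved vector so that it kills \<open>b\<close> too.\<close>

lemma separating_vector_list:
  assumes "set bs \<subseteq> carrier_vec n" "v \<in> carrier_vec n" "v \<notin> span (set bs)"
  shows "\<exists>w \<in> carrier_vec n. (\<forall>b \<in> set bs. w \<bullet> b = 0) \<and> w \<bullet> v = 1"
  using assms
proof (induction bs arbitrary: v)
  case Nil
  have "v \<noteq> 0\<^sub>v n"
    using Nil.prems(3) by (auto simp: span_empty)
  then obtain i where i: "i < n" "v $ i \<noteq> 0"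
    using Nil.prems(2) by (metis carrier_vecD eq_vecI index_zero_vec(1) index_zero_vec(2))
  define w where "w = inverse (v $ i) \<cdot>\<^sub>v unit_vec n i"
  have "w \<bullet> v = 1"
    using i Nil.prems(2) by (simp add: w_def)
  then show ?case
    by (intro bexI[of _ w]) (auto simp: w_def)
next
  case (Cons b bs)
  have b: "b \<in> carrier_vec n" and bs: "set bs \<subseteq> carrier_vec n"
    and v: "v \<in> carrier_vec n"
    using Cons.prems by auto
  have sub: "span (set bs) \<subseteq> span (set (b # bs))"
    by (rule span_is_monotone) auto
  show ?case
  proof (cases "b \<in> span (set bs)")
    case True
    obtain w where w: "w \<in> carrier_vec n" "\<forall>x \<in> set bs. w \<bullet> x = 0" "w \<bullet> v = 1"
      using Cons.IH[OF bs v] Cons.prems(3) sub by blast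
    have "w \<in> orthogonal_complement (span (set bs))"
      unfolding in_orthogonal_complement_span[OF bs]
      using w by (simp add: orthogonal_complement_def)
    then have "w \<bullet> b = 0"
      using True by (simp add: orthogonal_complement_def)
    then show ?thesis
      using w by auto
  next
    case False
    obtain u where u: "u \<in> carrier_vec n" "\<forall>x \<in> set bs. u \<bullet> x = 0" "u \<bullet> b = 1"
      using Cons.IH[OF bs b False] by blast
    define v' where "v' = v - (u \<bullet> v) \<cdot>\<^sub>v b"
    have v': "v' \<in> carrier_vec n"
      using v b by (simp add: v'_def)
    have "v' \<notin> span (set bs)"
    proof
      assume "v' \<in> span (set bs)"
      then have "v' \<in> span (set (b # bs))"
        using sub by blast
      moreover have "(u \<bullet> v) \<cdot>\<^sub>v b \<in> span (set (b # bs))"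
        using Cons.prems(1) b by (intro smult_in_span span_mem) auto
      ultimately have "v' + (u \<bullet> v) \<cdot>\<^sub>v b \<in> span (set (b # bs))"
        using Cons.prems(1) by (intro span_add1) auto
      moreover have "v' + (u \<bullet> v) \<cdot>\<^sub>v b = v"
        using v b by (auto simp: v'_def)
      ultimately show False
        using Cons.prems(3) by simp
    qed
    then obtain w where w: "w \<in> carrier_vec n" "\<forall>x \<in> set bs. w \<bullet> x = 0" "w \<bullet> v' = 1"
      using Cons.IH[OF bs v'] by blast
    define w' where "w' = w - (w \<bullet> b) \<cdot>\<^sub>v u"
    have eval: "w' \<bullet> x = w \<bullet> x - (w \<bullet> b) * (u \<bullet> x)" if "x \<in> carrier_vec n" for x
      using that w(1) u(1) by (simp add: w'_def minus_scalar_prod_distrib)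
    have "w \<bullet> v' = w \<bullet> v - (u \<bullet> v) * (w \<bullet> b)"
      using w(1) v b by (simp add: v'_def scalar_prod_minus_distrib)
    then have "w' \<bullet> v = 1"
      using eval[OF v] w(3) by (simp add: mult.commute)
    moreover have "w' \<bullet> x = 0" if "x \<in> set (b # bs)" for x
      using that eval[of x] w u b bs by auto
    ultimately show ?thesis
      using w(1) u(1) by (intro bexI[of _ w']) (auto simp: w'_def)
  qed
qed

text \<open>A linearly independent subset of \<open>W\<close> that cannot be enlarged inside \<open>W\<close> exists because
  independent sets have at most \<open>n\<close> elements; it spans \<open>W\<close>.\<close>

lemma submodule_finite_span:
  assumes W: "submodule class_ring W V"
  shows "\<exists>bs. set bs \<subseteq> W \<and> span (set bs) = W"
proof -
  have WV: "W \<subseteq> carrier_vec n"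
    using submodule.subset[OF W] by simp
  let ?P = "\<lambda>S. S \<subseteq> W \<and> lin_indpt S"
  have "\<exists>S. finite S \<and> maximal S ?P"
  proof (rule maximal_exists)
    show "finite S \<and> card S \<le> dim" if "?P S" for S
      using that WV li_le_dim[OF fin_dim] by auto
    show "?P {}"
      by (auto simp: lin_dep_def)
  qed
  then obtain S where S: "finite S" and max: "maximal S ?P"
    by (rule exE) (erule conjE)
  then have SW: "S \<subseteq> W" "lin_indpt S"
    by (simp_all add: maximal_def)
  have "w \<in> span S" if w: "w \<in> W" for w
  proof (cases "w \<in> S")
    case True
    then show ?thesis using SW(1) WV by (intro span_mem) auto
  next
    case False
    then have "lin_dep (insert w S)"
      using max SW(1) w unfolding maximal_def by (metis insert_subset insertI1 subset_insertI)
    moreover have "S \<subseteq> carrier_vec n" "w \<in> carrier_vec n"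
      using SW(1) w WV by auto
    ultimately show ?thesis
      using lin_dep_iff_in_span[of S w] SW(2) False by simp
  qed
  moreover have "span S \<subseteq> W"
    using SW(1) W by (rule span_is_subset)
  ultimately show ?thesis
    using finite_list[OF S] SW(1) by (metis subset_antisym subsetI)
qed

theorem double_orthogonal_complement:
  assumes W: "submodule class_ring W V"
  shows "orthogonal_complement (orthogonal_complement W) = W"
proof
  have WV: "W \<subseteq> carrier_vec n"
    using submodule.subset[OF W] by simp
  show "W \<subseteq> orthogonal_complement (orthogonal_complement W)"
  proof
    fix x assume x: "x \<in> W"
    have "x \<bullet> y = 0" if "y \<in> orthogonal_complement W" for y
    proof -
      have "y \<in> carrier_vec n" "y \<bullet> x = 0"
        using that x by (simp_all add: orthogonal_complement_def)
      then show ?thesis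
        using comm_scalar_prod[of x n y] x WV by (simp add: subset_iff)
    qed
    then show "x \<in> orthogonal_complement (orthogonal_complement W)"
      using x WV by (simp add: orthogonal_complement_def subset_iff)
  qed
  show "orthogonal_complement (orthogonal_complement W) \<subseteq> W"
  proof (rule subsetI, rule ccontr)
    fix v assume v: "v \<in> orthogonal_complement (orthogonal_complement W)" and "v \<notin> W"
    obtain bs where bs: "set bs \<subseteq> W" "span (set bs) = W"
      using submodule_finite_span[OF W] by blast
    have vc: "v \<in> carrier_vec n"
      using v by (simp add: orthogonal_complement_def)
    obtain w where w: "w \<in> carrier_vec n" "\<forall>b \<in> set bs. w \<bullet> b = 0" "w \<bullet> v = 1"
      using separating_vector_list[of bs v] bs WV vc \<open>v \<notin> W\<close> by auto
    have "set bs \<subseteq> carrier_vec n" using bs(1) WV by simp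
    from in_orthogonal_complement_span[OF this]
    have "w \<in> orthogonal_complement W"
      using w(1,2) unfolding bs(2) by (simp add: orthogonal_complement_def)
    then have "v \<bullet> w = 0"
      using v by (simp add: orthogonal_complement_def)
    then show False
      using w(1,3) vc by (simp add: comm_scalar_prod)
  qed
qed

lemma orthogonal_complement_submodule:
  assumes "W \<subseteq> carrier_vec n"
  shows "submodule class_ring (orthogonal_complement W) V"
proof (rule submodule.intro)
  show "Module.module class_ring V"
    by (rule vec_module)
next
  show "orthogonal_complement W \<subseteq> carrier V"
    by (auto simp: orthogonal_complement_def)
next
  fix v w assume "v \<in> orthogonal_complement W" "w \<in> orthogonal_complement W"
  then show "v \<oplus>\<^bsub>V\<^esub> w \<in> orthogonal_complement W"
    using assms by (simp add: orthogonal_complement_def subset_iff add_scalar_prod_distrib[where n = n])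
next
  show "\<zero>\<^bsub>V\<^esub> \<in> orthogonal_complement W"
    using assms by (simp add: orthogonal_complement_def subset_iff)
next
  fix c v assume "v \<in> orthogonal_complement W"
  then show "c \<odot>\<^bsub>V\<^esub> v \<in> orthogonal_complement W"
    using assms by (simp add: orthogonal_complement_def subset_iff smult_scalar_prod_distrib[where n = n])
qed

end

section \<open>Restriction to a star and extension by zero\<close>

lemma star_idx_finite [simp]: "finite (star_idx I \<sigma>)"
  by (simp add: star_idx_def)

lemma star_idx_less: "i \<in> star_idx I \<sigma> \<Longrightarrow> i < length I"
  by (simp add: star_idx_def)

lemma star_idx_bounded [simp]: "{i. i < length I \<and> i \<in> star_idx I \<sigma>} = star_idx I \<sigma>"
  by (auto simp: star_idx_def)

lemma star_idx_antimono: "\<sigma> \<le> \<tau> \<Longrightarrow> star_idx I \<tau> \<subseteq> star_idx I \<sigma>"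
  by (auto simp: star_idx_def St_def)

text \<open>Turns sums over the coordinates of a stalk, numbered from \<open>0\<close>, into sums over the original
  positions.\<close>

lemma pick_bij_betw: "finite S \<Longrightarrow> bij_betw (pick S) {..<card S} S"
proof -
  assume S: "finite S"
  have "inj_on (pick S) {..<card S}"
    by (intro inj_onI) (metis card_pick lessThan_iff)
  moreover have "pick S ` {..<card S} = S"
    using S calculation by (intro card_subset_eq) (auto simp: pick_in_set card_image)
  ultimately show ?thesis by (simp add: bij_betw_def)
qed

lemma pick_star_idx: "k < stalk_dim I \<sigma> \<Longrightarrow> pick (star_idx I \<sigma>) k \<in> star_idx I \<sigma>"
  by (simp add: stalk_dim_def pick_in_set)

lemma extend_zero_carrier [simp]: "extend_zero I \<sigma> v \<in> carrier_vec (length I)"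
  by (simp add: extend_zero_def)

lemma restrict_star_carrier [simp]: "restrict_star I \<sigma> w \<in> carrier_vec (stalk_dim I \<sigma>)"
  by (simp add: restrict_star_def)

lemma extend_zero_dim [simp]: "dim_vec (extend_zero I \<sigma> v) = length I"
  by (simp add: extend_zero_def)

lemma restrict_star_dim [simp]: "dim_vec (restrict_star I \<sigma> w) = stalk_dim I \<sigma>"
  by (simp add: restrict_star_def)

lemma extend_zero_outside:
  "j < length I \<Longrightarrow> j \<notin> star_idx I \<sigma> \<Longrightarrow> extend_zero I \<sigma> v $ j = 0"
  by (simp add: extend_zero_def)

lemma card_below_less_stalk_dim:
  assumes "j \<in> star_idx I \<sigma>"
  shows "card {i \<in> star_idx I \<sigma>. i < j} < stalk_dim I \<sigma>"
  unfolding stalk_dim_def using assms by (intro psubset_card_mono) auto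

lemma restrict_star_extend_zero:
  "v \<in> carrier_vec (stalk_dim I \<sigma>) \<Longrightarrow> restrict_star I \<sigma> (extend_zero I \<sigma> v) = v"
  using pick_star_idx[of _ I \<sigma>] star_idx_less
  by (intro eq_vecI)
    (force simp: restrict_star_def extend_zero_def card_pick stalk_dim_def)+

lemma extend_zero_restrict_star:
  "j \<in> star_idx I \<sigma> \<Longrightarrow> extend_zero I \<sigma> (restrict_star I \<sigma> w) $ j = w $ j"
  using card_below_less_stalk_dim[of j I \<sigma>] star_idx_less[of j I \<sigma>]
  by (simp add: restrict_star_def extend_zero_def pick_card_in_set)

lemma restrict_star_cong:
  "(\<And>j. j \<in> star_idx I \<sigma> \<Longrightarrow> w $ j = w' $ j) \<Longrightarrow> restrict_star I \<sigma> w = restrict_star I \<sigma> w'"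
  by (auto simp: restrict_star_def pick_star_idx intro!: eq_vecI)

lemma restrict_star_add:
  assumes "w \<in> carrier_vec (length I)" "w' \<in> carrier_vec (length I)"
  shows "restrict_star I \<sigma> (w + w') = restrict_star I \<sigma> w + restrict_star I \<sigma> w'"
  using assms pick_star_idx[of _ I \<sigma>] star_idx_less
  by (intro eq_vecI) (force simp: restrict_star_def)+

lemma restrict_star_smult:
  assumes "w \<in> carrier_vec (length I)"
  shows "restrict_star I \<sigma> (c \<cdot>\<^sub>v w) = c \<cdot>\<^sub>v restrict_star I \<sigma> w"
  using assms pick_star_idx[of _ I \<sigma>] star_idx_less
  by (intro eq_vecI) (force simp: restrict_star_def)+

lemma extend_zero_add:
  assumes "v \<in> carrier_vec (stalk_dim I \<sigma>)" "v' \<in> carrier_vec (stalk_dim I \<sigma>)"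
  shows "extend_zero I \<sigma> (v + v') = extend_zero I \<sigma> v + extend_zero I \<sigma> (v' :: 'a :: monoid_add vec)"
  using assms card_below_less_stalk_dim[of _ I \<sigma>]
  by (intro eq_vecI) (auto simp: extend_zero_def)

lemma extend_zero_smult:
  assumes "v \<in> carrier_vec (stalk_dim I \<sigma>)"
  shows "extend_zero I \<sigma> (c \<cdot>\<^sub>v v) = c \<cdot>\<^sub>v extend_zero I \<sigma> (v :: 'a :: mult_zero vec)"
  using assms card_below_less_stalk_dim[of _ I \<sigma>]
  by (intro eq_vecI) (auto simp: extend_zero_def)

text \<open>The adjunction that moves a scalar product from a stalk to the full list of generators and
  back: the positions outside the star contribute nothing, since the extension is zero there.\<close>

lemma restrict_star_scalar_prod:
  fixes w :: "'a :: semiring_0 vec"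
  assumes "v \<in> carrier_vec (stalk_dim I \<sigma>)"
  shows "restrict_star I \<sigma> w \<bullet> v = w \<bullet> extend_zero I \<sigma> v"
proof -
  let ?S = "star_idx I \<sigma>"
  have "restrict_star I \<sigma> w \<bullet> v =
    (\<Sum>k<card ?S. w $ pick ?S k * extend_zero I \<sigma> v $ pick ?S k)"
    using assms pick_star_idx[of _ I \<sigma>] star_idx_less[of _ I \<sigma>]
    by (auto simp: scalar_prod_def restrict_star_def extend_zero_def stalk_dim_def card_pick
        atLeast0LessThan intro!: sum.cong)
  also have "\<dots> = (\<Sum>j\<in>?S. w $ j * extend_zero I \<sigma> v $ j)"
    by (rule sum.reindex_bij_betw[OF pick_bij_betw]) simp
  also have "\<dots> = w \<bullet> extend_zero I \<sigma> v"
    unfolding scalar_prod_def extend_zero_dim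
    by (intro sum.mono_neutral_left) (auto simp: star_idx_less extend_zero_outside)
  finally show ?thesis .
qed

lemma star_submatrix_dims:
  assumes "M \<in> carrier_mat (length J) (length I)"
  shows "star_submatrix I J M \<sigma> \<in> carrier_mat (stalk_dim J \<sigma>) (stalk_dim I \<sigma>)"
  using assms by (auto simp: star_submatrix_def dim_submatrix stalk_dim_def)

lemma row_star_submatrix:
  assumes M: "M \<in> carrier_mat (length J) (length I)" and k: "k < stalk_dim J \<sigma>"
  shows "row (star_submatrix I J M \<sigma>) k = restrict_star I \<sigma> (row M (pick (star_idx J \<sigma>) k))"
  using M k star_submatrix_dims[OF M, of \<sigma>]
    star_idx_less[OF pick_star_idx, of _ I \<sigma>] star_idx_less[OF pick_star_idx, of _ J \<sigma>]
  by (intro eq_vecI)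
    (auto simp: carrier_matD restrict_star_def star_submatrix_def submatrix_index stalk_dim_def)

text \<open>The rows visible at \<open>\<sigma>\<close> as a set, in place of the submatrix. Appending a row then adds at most
  one element and the renumbering of the remaining rows does not matter. The second argument is
  the pair on which the algorithm operates.\<close>

definition star_rows :: "'p::order list \<Rightarrow> 'p list \<times> 'a mat \<Rightarrow> 'p \<Rightarrow> 'a vec set" where
  "star_rows I JM \<sigma> = (\<lambda>r. restrict_star I \<sigma> (row (snd JM) r)) ` star_idx (fst JM) \<sigma>"

lemma set_rows_star_submatrix:
  assumes M: "M \<in> carrier_mat (length J) (length I)"
  shows "set (rows (star_submatrix I J M \<sigma>)) = star_rows I (J, M) \<sigma>"
proof -
  have "set (rows (star_submatrix I J M \<sigma>)) =
    (\<lambda>k. restrict_star I \<sigma> (row M (pick (star_idx J \<sigma>) k))) ` {..<stalk_dim J \<sigma>}"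
    using star_submatrix_dims[OF M, of \<sigma>]
    by (auto simp: rows_def row_star_submatrix[OF M] atLeast0LessThan)
  also have "\<dots> = (\<lambda>r. restrict_star I \<sigma> (row M r)) ` pick (star_idx J \<sigma>) ` {..<stalk_dim J \<sigma>}"
    by (simp only: image_image)
  also have "pick (star_idx J \<sigma>) ` {..<stalk_dim J \<sigma>} = star_idx J \<sigma>"
    using pick_bij_betw[of "star_idx J \<sigma>"] by (simp add: bij_betw_def stalk_dim_def)
  also have "(\<lambda>r. restrict_star I \<sigma> (row M r)) ` star_idx J \<sigma> = star_rows I (J, M) \<sigma>"
    by (simp add: star_rows_def)
  finally show ?thesis .
qed

text \<open>Describes the natural transformation through the full matrix, which is the same for all
  \<open>\<sigma>\<close>; linearity and naturality become statements about \<^const>\<open>extend_zero\<close> and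
  \<^const>\<open>restrict_star\<close> only.\<close>

lemma nt_of_matrix_eq:
  assumes M: "M \<in> carrier_mat (length J) (length I)"
    and v: "v \<in> carrier_vec (stalk_dim I \<sigma>)"
  shows "nt_of_matrix I J M \<sigma> v = restrict_star J \<sigma> (M *\<^sub>v extend_zero I \<sigma> v)"
  using M star_submatrix_dims[OF M, of \<sigma>] v star_idx_less[OF pick_star_idx, of _ J \<sigma>]
  by (intro eq_vecI)
    (auto simp: nt_of_matrix_def row_star_submatrix restrict_star_scalar_prod, simp add: restrict_star_def)

section \<open>Sheaves and natural transformations from generators\<close>

lemma linear_map_vecI:
  fixes f :: "'a::field vec \<Rightarrow> 'a vec"
  assumes "\<And>v. v \<in> carrier_vec n \<Longrightarrow> f v \<in> carrier_vec m"
    and "\<And>v w. v \<in> carrier_vec n \<Longrightarrow> w \<in> carrier_vec n \<Longrightarrow> f (v + w) = f v + f w"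
    and "\<And>c v. v \<in> carrier_vec n \<Longrightarrow> f (c \<cdot>\<^sub>v v) = c \<cdot>\<^sub>v f v"
  shows "linear_map class_ring (module_vec TYPE('a) n) (module_vec TYPE('a) m) f"
proof -
  have "f \<in> LinearCombinations.module_hom class_ring (module_vec TYPE('a) n) (module_vec TYPE('a) m)"
    unfolding LinearCombinations.module_hom_def
    by (intro CollectI conjI Pi_I allI impI; simp add: module_vec_simps assms)
  then show ?thesis
    by (intro linear_map.intro LinearCombinations.mod_hom.intro
        LinearCombinations.mod_hom_axioms.intro vec_vs vec_module)
qed

lemma inj_sheaf_stalk [simp]:
  "stalk (inj_sheaf I) \<sigma> = module_vec TYPE('a::field) (stalk_dim I \<sigma>)"
  by (simp add: inj_sheaf_def)

lemma carrier_module_vec [simp]: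
  "carrier (module_vec TYPE('a::field) n) = carrier_vec n"
  by (simp add: module_vec_simps)

lemma inj_sheaf_res [simp]:
  "res (inj_sheaf I) \<sigma> \<tau> v = restrict_star I \<tau> (extend_zero I \<sigma> v)"
  by (simp add: inj_sheaf_def)

text \<open>Functoriality of the restriction maps: a coordinate deleted at \<open>\<sigma>\<close> is also deleted at every
  larger \<open>\<tau>\<close>.\<close>

lemma restrict_star_extend_restrict:
  assumes "\<sigma> \<le> \<tau>"
  shows "restrict_star I \<tau> (extend_zero I \<sigma> (restrict_star I \<sigma> w)) = restrict_star I \<tau> w"
  using star_idx_antimono[OF assms, of I]
  by (intro restrict_star_cong) (auto simp: extend_zero_restrict_star)

theorem is_sheaf_inj_sheaf:
  "is_sheaf (inj_sheaf I :: ('p::order, 'a::field, 'a vec) sheaf)"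
proof -
  have "vectorspace class_ring (module_vec TYPE('a) n)"
    "vectorspace.fin_dim class_ring (module_vec TYPE('a) n)" for n
  proof -
    interpret vec_space "TYPE('a)" n .
    show "vectorspace class_ring (module_vec TYPE('a) n)"
      by (rule vec_vs)
    show "vectorspace.fin_dim class_ring (module_vec TYPE('a) n)"
      by simp
  qed
  moreover have "linear_map class_ring (module_vec TYPE('a) (stalk_dim I \<sigma>))
      (module_vec TYPE('a) (stalk_dim I \<tau>)) (res (inj_sheaf I) \<sigma> \<tau>)" for \<sigma> \<tau>
    by (rule linear_map_vecI)
      (simp_all add: extend_zero_add extend_zero_smult restrict_star_add restrict_star_smult)
  ultimately show ?thesis
    by (simp add: is_sheaf_def restrict_star_extend_zero restrict_star_extend_restrict)
qed

text \<open>A row labeled in \<open>St \<tau>\<close> has nonzero entries only in columns labeled in \<open>St \<tau>\<close>, by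
  transitivity of the order. Hence deleting the other coordinates before applying the matrix does
  not change the rows that remain at \<open>\<tau>\<close>.\<close>

theorem nat_trans_nt_of_matrix:
  fixes M :: "'a::field mat"
  assumes M: "nt_matrix I J M"
  shows "nat_trans (inj_sheaf I) (inj_sheaf J) (nt_of_matrix I J M)"
proof -
  have Mc: "M \<in> carrier_mat (length J) (length I)"
    and M0: "\<And>r c. r < length J \<Longrightarrow> c < length I \<Longrightarrow> \<not> J ! r \<le> I ! c \<Longrightarrow> M $$ (r, c) = 0"
    using M by (auto simp: nt_matrix_def)
  have Me: "M *\<^sub>v extend_zero I \<sigma> v \<in> carrier_vec (length J)" for \<sigma> v
    using Mc by simp
  have "linear_map class_ring (module_vec TYPE('a) (stalk_dim I \<sigma>))
      (module_vec TYPE('a) (stalk_dim J \<sigma>)) (nt_of_matrix I J M \<sigma>)" for \<sigma>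
    by (rule linear_map_vecI)
      (simp_all add: nt_of_matrix_eq[OF Mc] extend_zero_add extend_zero_smult
        mult_add_distrib_mat_vec[OF Mc] mult_mat_vec[OF Mc]
        restrict_star_add[OF Me Me] restrict_star_smult[OF Me])
  moreover have "nt_of_matrix I J M \<tau> (res (inj_sheaf I) \<sigma> \<tau> v)
      = res (inj_sheaf J) \<sigma> \<tau> (nt_of_matrix I J M \<sigma> v)"
    if le: "\<sigma> \<le> \<tau>" and v: "v \<in> carrier_vec (stalk_dim I \<sigma>)" for \<sigma> \<tau> v
  proof -
    let ?x = "extend_zero I \<sigma> v"
    let ?y = "extend_zero I \<tau> (restrict_star I \<tau> ?x)"
    have "(M *\<^sub>v ?y) $ r = (M *\<^sub>v ?x) $ r" if r: "r \<in> star_idx J \<tau>" for r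
    proof -
      have rJ: "r < length J" and tr: "\<tau> \<le> J ! r"
        using r by (simp_all add: star_idx_def St_def)
      have "M $$ (r, c) * ?y $ c = M $$ (r, c) * ?x $ c" if c: "c < length I" for c
      proof (cases "c \<in> star_idx I \<tau>")
        case True
        then show ?thesis by (simp add: extend_zero_restrict_star)
      next
        case False
        then have "\<not> J ! r \<le> I ! c"
          using c tr by (auto simp: star_idx_def St_def)
        then show ?thesis
          using M0[OF rJ c] by simp
      qed
      then have "(\<Sum>c = 0..<length I. M $$ (r, c) * ?y $ c) = (\<Sum>c = 0..<length I. M $$ (r, c) * ?x $ c)"
        by (intro sum.cong) simp_all
      then show ?thesis
        using Mc rJ by (simp add: scalar_prod_def)
    qed
    then have "restrict_star J \<tau> (M *\<^sub>v ?y) = restrict_star J \<tau> (M *\<^sub>v ?x)"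
      by (rule restrict_star_cong)
    then show ?thesis
      using v le by (simp add: nt_of_matrix_eq[OF Mc] restrict_star_extend_restrict)
  qed
  ultimately show ?thesis
    by (simp add: nat_trans_def)
qed

section \<open>Appending a row\<close>

lemma nt_matrix_append:
  assumes "nt_matrix I J N"
  shows "nt_matrix I (J @ [\<sigma>]) (N @\<^sub>r mat_of_row (extend_zero I \<sigma> b))"
  using assms
  by (auto simp: nt_matrix_def append_rows_def nth_append less_Suc_eq star_idx_def St_def
      extend_zero_def)

lemma row_append_mat_of_row:
  assumes "N \<in> carrier_mat m n" "w \<in> carrier_vec n" "r \<le> m"
  shows "row (N @\<^sub>r mat_of_row w) r = (if r < m then row N r else w)"
  using assms by (intro eq_vecI) (auto simp: append_rows_def)

lemma star_rows_append:
  assumes N: "N \<in> carrier_mat (length J) (length I)" and w: "w \<in> carrier_vec (length I)"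
  shows "star_rows I (J @ [\<rho>], N @\<^sub>r mat_of_row w) \<sigma> =
    star_rows I (J, N) \<sigma> \<union> (if \<sigma> \<le> \<rho> then {restrict_star I \<sigma> w} else {})"
proof -
  have "star_idx (J @ [\<rho>]) \<sigma> = star_idx J \<sigma> \<union> (if \<sigma> \<le> \<rho> then {length J} else {})"
    by (auto simp: star_idx_def St_def nth_append less_Suc_eq)
  moreover have "row (N @\<^sub>r mat_of_row w) r = row N r" if "r \<in> star_idx J \<sigma>" for r
    using row_append_mat_of_row[OF N w, of r] star_idx_less[OF that] by simp
  moreover have "row (N @\<^sub>r mat_of_row w) (length J) = w"
    using row_append_mat_of_row[OF N w, of "length J"] by simp
  ultimately show ?thesis
    by (simp add: star_rows_def image_Un cong: image_cong_simp)
qed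

section \<open>Invariants of the resolution step\<close>

abbreviation vec_span :: "nat \<Rightarrow> 'a::field vec set \<Rightarrow> 'a vec set" where
  "vec_span n \<equiv> LinearCombinations.module.span class_ring (module_vec TYPE('a) n)"

lemma process_vector_eq:
  assumes "N \<in> carrier_mat (length J) (length I)"
  shows "process_vector I \<sigma> b (J, N) =
    (if b \<in> vec_span (stalk_dim I \<sigma>) (star_rows I (J, N) \<sigma>) then (J, N)
     else (J @ [\<sigma>], N @\<^sub>r mat_of_row (extend_zero I \<sigma> b)))"
  by (simp add: process_vector_def set_rows_star_submatrix[OF assms])

lemma star_rows_carrier: "star_rows I s \<sigma> \<subseteq> carrier_vec (stalk_dim I \<sigma>)"
  by (auto simp: star_rows_def)

text \<open>The family \<open>W\<close> stands for the orthogonal complements of the images. The hypothesis \<open>extend\<close>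
  says that it is stable under the way in which a vector found at \<open>\<rho>\<close> appears at the elements below
  \<open>\<rho>\<close>; this is what keeps all rows inside \<open>W\<close>. The last conclusion holds in both cases of the
  algorithm: a vector that is not appended was already in the span.\<close>

lemma process_vector_step:
  fixes W :: "'p::order \<Rightarrow> 'a::field vec set"
  assumes extend: "\<And>\<sigma> \<rho> b. \<sigma> \<le> \<rho> \<Longrightarrow> b \<in> W \<rho> \<Longrightarrow> restrict_star I \<sigma> (extend_zero I \<rho> b) \<in> W \<sigma>"
    and s: "nt_matrix I (fst s) (snd s)" "\<And>\<sigma>. star_rows I s \<sigma> \<subseteq> W \<sigma>"
    and b: "b \<in> W \<rho>" "b \<in> carrier_vec (stalk_dim I \<rho>)"
  defines "s' \<equiv> process_vector I \<rho> b s"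
  shows "nt_matrix I (fst s') (snd s')" "star_rows I s' \<sigma> \<subseteq> W \<sigma>"
    "star_rows I s \<sigma> \<subseteq> star_rows I s' \<sigma>"
    "b \<in> vec_span (stalk_dim I \<rho>) (star_rows I s' \<rho>)"
proof -
  obtain J N where sJN: "s = (J, N)" by fastforce
  have N: "N \<in> carrier_mat (length J) (length I)"
    using s(1) by (simp add: sJN nt_matrix_def)
  interpret vec_space "TYPE('a)" "stalk_dim I \<rho>" .
  note eq = s'_def[unfolded sJN process_vector_eq[OF N]]
  have rows: "star_rows I (J @ [\<rho>], N @\<^sub>r mat_of_row (extend_zero I \<rho> b)) \<sigma> =
    star_rows I (J, N) \<sigma> \<union> (if \<sigma> \<le> \<rho> then {restrict_star I \<sigma> (extend_zero I \<rho> b)} else {})" for \<sigma>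
    by (rule star_rows_append[OF N]) simp
  show "nt_matrix I (fst s') (snd s')"
    using s(1) nt_matrix_append[of I J N \<rho> b] by (simp add: eq sJN)
  show "star_rows I s' \<sigma> \<subseteq> W \<sigma>"
    using s(2)[of \<sigma>] extend[of \<sigma> \<rho> b] b(1) by (auto simp: eq sJN rows split: if_splits)
  show "star_rows I s \<sigma> \<subseteq> star_rows I s' \<sigma>"
    by (simp add: eq sJN rows)
  show "b \<in> vec_span (stalk_dim I \<rho>) (star_rows I s' \<rho>)"
  proof (cases "b \<in> span (star_rows I (J, N) \<rho>)")
    case True
    then show ?thesis by (simp add: eq)
  next
    case False
    then have "b \<in> star_rows I s' \<rho>"
      using b(2) by (simp add: eq rows restrict_star_extend_zero)
    then show ?thesis
      by (intro span_mem star_rows_carrier)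
  qed
qed

text \<open>The span reached by one vector persists because the rows at each \<open>\<sigma>\<close> only grow.\<close>

lemma fold_process_vector:
  fixes W :: "'p::order \<Rightarrow> 'a::field vec set"
  assumes extend: "\<And>\<sigma> \<rho> b. \<sigma> \<le> \<rho> \<Longrightarrow> b \<in> W \<rho> \<Longrightarrow> restrict_star I \<sigma> (extend_zero I \<rho> b) \<in> W \<sigma>"
    and W: "\<And>\<sigma>. W \<sigma> \<subseteq> carrier_vec (stalk_dim I \<sigma>)"
    and "\<And>\<sigma> b. (\<sigma>, b) \<in> set ps \<Longrightarrow> b \<in> W \<sigma>"
    and "nt_matrix I (fst s) (snd s)" "\<And>\<sigma>. star_rows I s \<sigma> \<subseteq> W \<sigma>"
  defines "s' \<equiv> fold (\<lambda>(\<sigma>, b). process_vector I \<sigma> b) ps s"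
  shows "nt_matrix I (fst s') (snd s') \<and> (\<forall>\<sigma>. star_rows I s' \<sigma> \<subseteq> W \<sigma>) \<and>
    (\<forall>\<sigma>. star_rows I s \<sigma> \<subseteq> star_rows I s' \<sigma>) \<and>
    (\<forall>(\<sigma>, b) \<in> set ps. b \<in> vec_span (stalk_dim I \<sigma>) (star_rows I s' \<sigma>))"
  using assms(3-5) unfolding s'_def
proof (induction ps arbitrary: s)
  case Nil
  then show ?case by simp
next
  case (Cons p ps)
  obtain \<rho> b where p: "p = (\<rho>, b)" by fastforce
  have b: "b \<in> W \<rho>" "b \<in> carrier_vec (stalk_dim I \<rho>)"
    using Cons.prems(1)[of \<rho> b] W[of \<rho>] by (auto simp: p)
  let ?s1 = "process_vector I \<rho> b s"
  let ?s' = "fold (\<lambda>(\<sigma>, b). process_vector I \<sigma> b) ps ?s1"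
  note step = process_vector_step[OF extend Cons.prems(2,3) b]
  have IH: "nt_matrix I (fst ?s') (snd ?s') \<and> (\<forall>\<sigma>. star_rows I ?s' \<sigma> \<subseteq> W \<sigma>) \<and>
    (\<forall>\<sigma>. star_rows I ?s1 \<sigma> \<subseteq> star_rows I ?s' \<sigma>) \<and>
    (\<forall>(\<sigma>, b) \<in> set ps. b \<in> vec_span (stalk_dim I \<sigma>) (star_rows I ?s' \<sigma>))"
    using Cons.prems(1) by (intro Cons.IH step(1,2)) auto
  interpret vec_space "TYPE('a)" "stalk_dim I \<rho>" .
  have "b \<in> span (star_rows I ?s' \<rho>)"
    using step(4) IH span_is_monotone[of "star_rows I ?s1 \<rho>" "star_rows I ?s' \<rho>"] by blast
  moreover have "star_rows I s \<sigma> \<subseteq> star_rows I ?s' \<sigma>" for \<sigma>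
    using IH step(3)[of \<sigma>] by (meson order_trans)
  ultimately show ?case
    using IH by (simp add: p)
qed

text \<open>Flattens the loop over elements and the loop over basis vectors into one, so that a single
  induction covers the run.\<close>

lemma resolution_run_eq_fold:
  "resolution_run I \<sigma>s B =
    fold (\<lambda>(\<sigma>, b). process_vector I \<sigma> b) (concat (map (\<lambda>\<sigma>. map (Pair \<sigma>) (B \<sigma>)) (rev \<sigma>s)))
      ([], 0\<^sub>m 0 (length I))"
proof -
  have "fold (\<lambda>\<sigma>. fold (process_vector I \<sigma>) (B \<sigma>)) xs s =
    fold (\<lambda>(\<sigma>, b). process_vector I \<sigma> b) (concat (map (\<lambda>\<sigma>. map (Pair \<sigma>) (B \<sigma>)) xs)) s" for xs s
    by (induction xs arbitrary: s) (simp_all add: fold_map comp_def)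
  then show ?thesis
    by (simp add: resolution_run_def)
qed

text \<open>Being a basis of \<open>W\<close> refers to spans inside \<open>W\<close> as a vector space of its own; they agree with
  the spans in the ambient space.\<close>

lemma span_ordered_basis:
  fixes W :: "'a::field vec set"
  assumes bs: "ordered_basis n W bs" and W: "submodule class_ring W (module_vec TYPE('a) n)"
  shows "set bs \<subseteq> W" "vec_span n (set bs) = W"
proof -
  interpret vec_space "TYPE('a)" n .
  interpret W: vectorspace class_ring "V\<lparr>carrier := W\<rparr>"
    by (intro subspace_is_vs VectorSpace.subspace.intro vec_vs W)
  have "W.basis (set bs)"
    using bs unfolding ordered_basis_def by (rule conjunct2)
  then have bsW: "set bs \<subseteq> W" and gen: "W.span (set bs) = W"
    unfolding W.basis_def by simp_all
  show "set bs \<subseteq> W"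
    by (rule bsW)
  show "span (set bs) = W"
    using span_li_not_depend(1)[OF bsW W] gen by (rule trans[OF sym])
qed

text \<open>The stability of the orthogonal complements under extension by zero combines the adjunction
  with naturality of \<open>\<eta>\<close>; the fold invariants do the rest.\<close>

theorem span_star_rows_resolution_step:
  fixes F :: "('p::order, 'a::field, 'v) sheaf" and N :: "'a mat"
  assumes F: "is_sheaf F" and \<eta>: "nat_trans F (inj_sheaf I) \<eta>"
    and step: "resolution_step F \<eta> I (J, N)"
  shows "nt_matrix I J N"
    "vec_span (stalk_dim I \<sigma>) (star_rows I (J, N) \<sigma>) =
      vec_module.orthogonal_complement (stalk_dim I \<sigma>) (\<eta> \<sigma> ` carrier (stalk F \<sigma>))"
proof -
  define W where "W \<sigma> = vec_module.orthogonal_complement (stalk_dim I \<sigma>)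
    (\<eta> \<sigma> ` carrier (stalk F \<sigma>))" for \<sigma>
  have W_iff: "b \<in> W \<sigma> \<longleftrightarrow> b \<in> carrier_vec (stalk_dim I \<sigma>) \<and>
      (\<forall>x \<in> carrier (stalk F \<sigma>). b \<bullet> \<eta> \<sigma> x = 0)" for \<sigma> b
    by (simp add: W_def vec_module.orthogonal_complement_def)
  have \<eta>_carrier: "\<eta> \<sigma> x \<in> carrier_vec (stalk_dim I \<sigma>)" if "x \<in> carrier (stalk F \<sigma>)" for \<sigma> x
  proof -
    interpret linear_map class_ring "stalk F \<sigma>" "module_vec TYPE('a) (stalk_dim I \<sigma>)" "\<eta> \<sigma>"
      using \<eta> by (simp add: nat_trans_def)
    show ?thesis using f_im[OF that] by simp
  qed
  have W_sub: "submodule class_ring (W \<sigma>) (module_vec TYPE('a) (stalk_dim I \<sigma>))" for \<sigma>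
  proof -
    interpret vec_space "TYPE('a)" "stalk_dim I \<sigma>" .
    show ?thesis
      unfolding W_def using \<eta>_carrier by (intro orthogonal_complement_submodule) auto
  qed
  have extend: "restrict_star I \<sigma> (extend_zero I \<rho> b) \<in> W \<sigma>"
    if le: "\<sigma> \<le> \<rho>" and b: "b \<in> W \<rho>" for \<sigma> \<rho> b
  proof -
    have bc: "b \<in> carrier_vec (stalk_dim I \<rho>)"
      using b by (simp add: W_iff)
    have "restrict_star I \<sigma> (extend_zero I \<rho> b) \<bullet> \<eta> \<sigma> x = 0"
      if x: "x \<in> carrier (stalk F \<sigma>)" for x
    proof -
      let ?y = "extend_zero I \<sigma> (\<eta> \<sigma> x)"
      interpret linear_map class_ring "stalk F \<sigma>" "stalk F \<rho>" "res F \<sigma> \<rho>"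
        using F le by (simp add: is_sheaf_def)
      have "restrict_star I \<sigma> (extend_zero I \<rho> b) \<bullet> \<eta> \<sigma> x = extend_zero I \<rho> b \<bullet> ?y"
        by (rule restrict_star_scalar_prod[OF \<eta>_carrier[OF x]])
      also have "\<dots> = ?y \<bullet> extend_zero I \<rho> b"
        by (rule comm_scalar_prod[where n = "length I"]) simp_all
      also have "\<dots> = restrict_star I \<rho> ?y \<bullet> b"
        by (rule restrict_star_scalar_prod[OF bc, symmetric])
      also have "\<dots> = b \<bullet> restrict_star I \<rho> ?y"
        by (rule comm_scalar_prod[OF _ bc]) simp
      also have "restrict_star I \<rho> ?y = \<eta> \<rho> (res F \<sigma> \<rho> x)"
        using \<eta> le x by (simp add: nat_trans_def)
      also have "b \<bullet> \<dots> = 0"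
        using b f_im[OF x] by (simp add: W_iff)
      finally show ?thesis .
    qed
    then show ?thesis
      by (simp add: W_iff)
  qed
  obtain \<sigma>s B where ext: "linear_extension \<sigma>s"
    and B: "\<And>\<sigma>. ordered_basis (stalk_dim I \<sigma>) (W \<sigma>) (B \<sigma>)"
    and run: "(J, N) = resolution_run I \<sigma>s B"
    using step by (auto simp: resolution_step_def W_def)
  note basis = span_ordered_basis[OF B W_sub]
  let ?ps = "concat (map (\<lambda>\<sigma>. map (Pair \<sigma>) (B \<sigma>)) (rev \<sigma>s))"
  have ps: "(\<rho>, b) \<in> set ?ps \<longleftrightarrow> b \<in> set (B \<rho>)" for \<rho> b
    using ext by (auto simp: linear_extension_def)
  have "nt_matrix I (fst (J, N)) (snd (J, N)) \<and> (\<forall>\<sigma>. star_rows I (J, N) \<sigma> \<subseteq> W \<sigma>) \<and>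
    (\<forall>\<sigma>. star_rows I ([], 0\<^sub>m 0 (length I)) \<sigma> \<subseteq> star_rows I (J, N) \<sigma>) \<and>
    (\<forall>(\<sigma>, b) \<in> set ?ps. b \<in> vec_span (stalk_dim I \<sigma>) (star_rows I (J, N) \<sigma>))"
    unfolding run resolution_run_eq_fold
  proof (rule fold_process_vector[OF extend])
    show "W \<sigma> \<subseteq> carrier_vec (stalk_dim I \<sigma>)" for \<sigma>
      by (auto simp: W_iff)
    show "b \<in> W \<rho>" if "(\<rho>, b) \<in> set ?ps" for \<rho> b
      using that basis(1) by (auto simp only: ps)
  qed (simp_all add: nt_matrix_def star_rows_def star_idx_def)
  then have rows: "nt_matrix I J N" "\<And>\<sigma>. star_rows I (J, N) \<sigma> \<subseteq> W \<sigma>"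
    and gen: "\<And>\<sigma>. set (B \<sigma>) \<subseteq> vec_span (stalk_dim I \<sigma>) (star_rows I (J, N) \<sigma>)"
    using ps by (simp_all, blast)
  show "nt_matrix I J N" by (rule rows(1))
  interpret vec_space "TYPE('a)" "stalk_dim I \<sigma>" .
  have "span (star_rows I (J, N) \<sigma>) \<subseteq> W \<sigma>"
    by (rule span_is_subset[OF rows(2) W_sub])
  moreover have "span (set (B \<sigma>)) \<subseteq> span (star_rows I (J, N) \<sigma>)"
    by (rule span_is_subset[OF gen span_is_submodule]) (simp add: star_rows_carrier)
  ultimately show "vec_span (stalk_dim I \<sigma>) (star_rows I (J, N) \<sigma>) =
      vec_module.orthogonal_complement (stalk_dim I \<sigma>) (\<eta> \<sigma> ` carrier (stalk F \<sigma>))"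
    using basis(2)[of \<sigma>] by (simp add: W_def)
qed

section \<open>Exactness\<close>

lemma ker_nt_of_matrix:
  fixes N :: "'a::field mat"
  assumes N: "N \<in> carrier_mat (length J) (length I)"
  shows "{v \<in> carrier_vec (stalk_dim I \<sigma>). nt_of_matrix I J N \<sigma> v = 0\<^sub>v (stalk_dim J \<sigma>)} =
    vec_module.orthogonal_complement (stalk_dim I \<sigma>) (star_rows I (J, N) \<sigma>)"
proof -
  have "nt_of_matrix I J N \<sigma> v = 0\<^sub>v (stalk_dim J \<sigma>) \<longleftrightarrow>
      (\<forall>r \<in> set (rows (star_submatrix I J N \<sigma>)). v \<bullet> r = 0)"
    if v: "v \<in> carrier_vec (stalk_dim I \<sigma>)" for v
    using star_submatrix_dims[OF N, of \<sigma>] comm_scalar_prod[OF v row_carrier_vec]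
    by (auto simp: nt_of_matrix_def rows_def vec_eq_iff)
  then show ?thesis
    by (auto simp: vec_module.orthogonal_complement_def set_rows_star_submatrix[OF N])
qed

theorem exact_at_resolution_step:
  fixes F :: "('p::order, 'a::field, 'v) sheaf" and N :: "'a mat"
  assumes F: "is_sheaf F" and \<eta>: "nat_trans F (inj_sheaf I) \<eta>"
    and step: "resolution_step F \<eta> I (J, N)"
  shows "exact_at F \<eta> (inj_sheaf I) (nt_of_matrix I J N) (inj_sheaf J)"
proof -
  note N = span_star_rows_resolution_step[OF assms]
  have Nc: "N \<in> carrier_mat (length J) (length I)"
    using N(1) by (simp add: nt_matrix_def)
  have "\<eta> \<sigma> ` carrier (stalk F \<sigma>) =
      {v \<in> carrier_vec (stalk_dim I \<sigma>). nt_of_matrix I J N \<sigma> v = 0\<^sub>v (stalk_dim J \<sigma>)}" for \<sigma>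
  proof -
    interpret vec_space "TYPE('a)" "stalk_dim I \<sigma>" .
    interpret \<eta>: linear_map class_ring "stalk F \<sigma>" V "\<eta> \<sigma>"
      using \<eta> by (simp add: nat_trans_def)
    have "\<eta> \<sigma> ` carrier (stalk F \<sigma>) = \<eta>.im"
      by (simp add: \<eta>.im_def)
    then have "submodule class_ring (\<eta> \<sigma> ` carrier (stalk F \<sigma>)) V"
      using \<eta>.imT_is_subspace by (simp add: VectorSpace.subspace_def)
    then have "\<eta> \<sigma> ` carrier (stalk F \<sigma>) =
        orthogonal_complement (span (star_rows I (J, N) \<sigma>))"
      by (simp only: N(2) double_orthogonal_complement)
    then show ?thesis
      by (simp only: ker_nt_of_matrix[OF Nc] in_orthogonal_complement_span[OF star_rows_carrier])
  qed
  then show ?thesis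
    using \<eta> nat_trans_nt_of_matrix[OF N(1)]
    by (simp add: exact_at_def module_vec_simps)
qed

theorem proposition27:
  fixes I\<^sub>k I\<^sub>k\<^sub>1 :: "'p::{finite,order} list"
    and \<eta>\<^sub>k :: "'a::field mat"
  shows
    "(\<forall>(I :: 'p list) (M :: 'a mat).
        nt_matrix I I\<^sub>k M \<longrightarrow>
        resolution_step (inj_sheaf I) (nt_of_matrix I I\<^sub>k M) I\<^sub>k (I\<^sub>k\<^sub>1, \<eta>\<^sub>k) \<longrightarrow>
        exact_at (inj_sheaf I) (nt_of_matrix I I\<^sub>k M) (inj_sheaf I\<^sub>k)
          (nt_of_matrix I\<^sub>k I\<^sub>k\<^sub>1 \<eta>\<^sub>k) (inj_sheaf I\<^sub>k\<^sub>1)) \<and>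
     (\<forall>(F :: ('p, 'a, 'v) sheaf) \<alpha>.
        is_sheaf F \<longrightarrow>
        nat_trans F (inj_sheaf I\<^sub>k) \<alpha> \<longrightarrow>
        resolution_step F \<alpha> I\<^sub>k (I\<^sub>k\<^sub>1, \<eta>\<^sub>k) \<longrightarrow>
        exact_at F \<alpha> (inj_sheaf I\<^sub>k) (nt_of_matrix I\<^sub>k I\<^sub>k\<^sub>1 \<eta>\<^sub>k) (inj_sheaf I\<^sub>k\<^sub>1))"
  by (intro conjI allI impI exact_at_resolution_step is_sheaf_inj_sheaf nat_trans_nt_of_matrix)

end
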